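(* Let $a<b$ be real numbers. Then $$IV(a,b)=\left\{\frac{1}{k+1}a+\frac{k}{k+1}b : k\in\mathbb{Z},\ k\geq 1\right\}.$$
   Context: For real numbers $a_1<a_2<\dots<a_r$, let $SEQ(a_1,\dots,a_r)$ be the set of all sequences $\{x_n\}_{n\geq 1}$ with $x_n\in\{a_1,\dots,a_r\}$ for all $n\geq 1$. For a sequence $\{x_n\}_{n\geq 1}$ put $\bar{x}_n=\frac{x_1+\dots+x_n}{n}$. Define $IV(a_1,\dots,a_r)$ to be the set of all real numbers $\Pi\in(a_1,a_r)$ (open interval) with the following property: whenever $\{x_n\}_{n\geq 1}\in SEQ(a_1,\dots,a_r)$ and $\bar{x}_k<\Pi<\bar{x}_l$ for some integers $1\leq k<l$, there exists an integer $s$ with $k<s<l$ such that $\bar{x}_s=\Pi$. *)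

theory Defs
  imports Complex_Main
begin

text \<open>
  The numbers a_1 < ... < a_r are given as a strictly increasing list.
  Sequences are indexed from 1: the value at index 0 is left unconstrained and is never used.
\<close>

definition SEQ :: "real list \<Rightarrow> (nat \<Rightarrow> real) set" where
  "SEQ as = {x. \<forall>n\<ge>1. x n \<in> set as}"

definition seq_mean :: "(nat \<Rightarrow> real) \<Rightarrow> nat \<Rightarrow> real" where
  "seq_mean x n = (\<Sum>i=1..n. x i) / real n"

text \<open>For a strictly increasing list, \<open>hd as\<close> is a_1 and \<open>last as\<close> is a_r.\<close>

definition IV :: "real list \<Rightarrow> real set" where
  "IV as = {p. hd as < p \<and> p < last as \<and>
     (\<forall>x\<in>SEQ as. \<forall>k l :: nat. 1 \<le> k \<and> k < l \<and> seq_mean x k < p \<and> p < seq_mean x l \<longrightarrow>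
        (\<exists>s. k < s \<and> s < l \<and> seq_mean x s = p))}"

end

theory Submission
  imports Defs
begin

text \<open>
  If \<open>p = (a + k b) / (k + 1)\<close> and \<open>d = (b - a) / (k + 1)\<close>, then \<open>b - p = d\<close> and \<open>a - p = - k d\<close>,
  so the partial sums of \<open>x i - p\<close> are integer multiples of \<open>d\<close> that rise by at most one unit per
  step and hence cannot jump upwards over zero. Conversely, the means of \<open>a, b, b, \<dots>\<close> are
  \<open>b - (b - a) / n\<close>; they increase to \<open>b\<close> and skip every value that is not one of them.
\<close>

text \<open>At the first index after \<open>k\<close> where \<open>z\<close> is nonnegative, the
  preceding value is at most -1, so a rise of at most 1 can only reach 0. Falls may be arbitrarily
  large.\<close>

lemma int_upward_crossing:
  fixes z :: "nat \<Rightarrow> int"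
  assumes step: "\<And>n. z (Suc n) \<le> z n + 1"
    and "k < l" "z k < 0" "0 < z l"
  shows "\<exists>s. k < s \<and> s < l \<and> z s = 0"
proof -
  define P where "P n \<longleftrightarrow> k < n \<and> 0 \<le> z n" for n
  define s where "s = (LEAST n. P n)"
  have "P l" using assms by (simp add: P_def)
  then have "P s" "s \<le> l" unfolding s_def by (auto intro: LeastI Least_le)
  then obtain m where m: "s = Suc m" "k \<le> m"
    by (cases s) (auto simp: P_def)
  have "\<not> P m" using m not_less_Least[of m P] by (simp add: s_def)
  \<comment> \<open>\<open>P\<close> only looks beyond \<open>k\<close>, so for \<open>m = k\<close>
    the sign comes from \<open>z k < 0\<close> and not from minimality.\<close>
  then have "z m < 0" using m \<open>z k < 0\<close> by (cases "m = k") (auto simp: P_def)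
  then have "z s = 0" using step[of m] \<open>P s\<close> m by (simp add: P_def)
  moreover have "s \<noteq> l" using \<open>z s = 0\<close> \<open>0 < z l\<close> by auto
  ultimately show ?thesis using \<open>P s\<close> \<open>s \<le> l\<close> by (auto simp: P_def)
qed

lemma weighted_mean_in_IV:
  fixes a b :: real and k :: int
  assumes "a < b" "k \<ge> 1"
  shows "1 / (real_of_int k + 1) * a + real_of_int k / (real_of_int k + 1) * b \<in> IV [a, b]"
    (is "?p \<in> _")
proof -
  define d where "d = (b - a) / (real_of_int k + 1)"
  have k: "real_of_int k \<ge> 1" using assms by simp
  then have d: "d > 0" using assms by (simp add: d_def)
  have p_eq: "?p = (a + real_of_int k * b) / (real_of_int k + 1)"
    by (simp add: add_divide_distrib)
  have pb: "b = ?p + d" and pa: "a = ?p - real_of_int k * d"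
    unfolding p_eq d_def times_divide_eq_right
      add_divide_distrib[symmetric] diff_divide_distrib[symmetric]
    using k by (simp_all add: eq_divide_eq algebra_simps)
  have bounds: "a < ?p" "?p < b"
    using pa pb d mult_pos_pos[of "real_of_int k" d] k by linarith+
  have "\<exists>s. m < s \<and> s < l \<and> seq_mean x s = ?p"
    if x: "x \<in> SEQ [a, b]" and ml: "1 \<le> m" "m < l" "seq_mean x m < ?p" "?p < seq_mean x l" for x m l
  proof -
    \<comment> \<open>This is the sum of the deviations \<open>x i - p\<close> in units of
      \<open>d\<close>. As \<open>d > 0\<close>, it has the sign of \<open>seq_mean x n - p\<close>
      and vanishes with it for \<open>n\<close> \<ge> 1.\<close>
    define z :: "nat \<Rightarrow> int" where "z n = (\<Sum>i=1..n. if x i = b then 1 else - k)" for n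
    have x_eq: "x i = ?p + d * real_of_int (if x i = b then 1 else - k)" if "i \<ge> 1" for i
    proof (cases "x i = b")
      case True
      then show ?thesis using pb by simp
    next
      case False
      then have "x i = a" using x that by (auto simp: SEQ_def)
      then show ?thesis using False pa by (simp add: mult.commute)
    qed
    have mean: "seq_mean x n = ?p + d * real_of_int (z n) / real n" if "n \<ge> 1" for n
    proof -
      have "(\<Sum>i=1..n. x i) = (\<Sum>i=1..n. ?p + d * real_of_int (if x i = b then 1 else - k))"
        by (rule sum.cong[OF refl], rule x_eq) simp
      also have "\<dots> = real n * ?p + d * real_of_int (z n)"
        unfolding z_def of_int_sum sum.distrib sum_distrib_left by (simp add: distrib_left)
      finally show ?thesis using that by (simp add: seq_mean_def add_divide_distrib)
    qed
    have "z (Suc n) \<le> z n + 1" for n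
      using \<open>k \<ge> 1\<close> by (simp add: z_def)
    moreover have "z m < 0"
      using ml d mean[of m] by (simp add: divide_less_0_iff mult_less_0_iff)
    moreover have "0 < z l"
      using ml d mean[of l] by (simp add: zero_less_divide_iff zero_less_mult_iff)
    ultimately obtain s where s: "m < s" "s < l" "z s = 0"
      using int_upward_crossing[of z m l] \<open>m < l\<close> by blast
    then show ?thesis using mean[of s] by auto
  qed
  then show ?thesis using bounds by (simp add: IV_def)
qed

text \<open>Against the constant sequence \<open>b\<close>, the sum falls short by
  \<open>b - a\<close> exactly once, and the mean spreads this deficit over \<open>n\<close>
  terms.\<close>

lemma seq_mean_one_exception:
  assumes "n \<ge> 1"
  shows "seq_mean (\<lambda>i. if i = 1 then a else b) n = b - (b - a) / real n"
proof -
  have "(\<Sum>i=1..n. if i = 1 then a else b) = a + (real n - 1) * b"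
    using assms by (induction n rule: dec_induct) (simp_all add: algebra_simps)
  then show ?thesis using assms by (simp add: seq_mean_def field_simps)
qed

lemma IV_imp_weighted_mean:
  fixes a b p :: real
  assumes "a < b" and p: "p \<in> IV [a, b]"
  shows "\<exists>k::int. p = 1 / (real_of_int k + 1) * a + real_of_int k / (real_of_int k + 1) * b \<and> k \<ge> 1"
proof -
  \<comment> \<open>The real "index" at which the mean \<open>b - (b - a) / t\<close> of the
    sequence a, b, b, ... would equal \<open>p\<close>; the goal is that it is an integer.\<close>
  define t where "t = (b - a) / (b - p)"
  have ab: "a < p" "p < b" using p by (auto simp: IV_def)
  then have "t > 1" by (simp add: t_def)
  have pt: "p = b - (b - a) / t" using ab \<open>a < b\<close> by (simp add: t_def)
  define n where "n = nat \<lfloor>t\<rfloor>"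
  have n: "n \<ge> 1" "real n \<le> t" "t < real (Suc n)"
    using \<open>t > 1\<close> by (simp_all add: n_def le_nat_iff, linarith)
  have "t = real n"
  proof (rule ccontr)
    assume "t \<noteq> real n"
    then have "real n < t" using n by simp
    let ?x = "\<lambda>i::nat. if i = 1 then a else b"
    \<comment> \<open>If \<open>t\<close> lies strictly between \<open>n\<close> and
      \<open>Suc n\<close>, the means at these indices enclose \<open>p\<close>, yet no index lies
      strictly between them.\<close>
    have "(b - a) / t < (b - a) / real n"
      using \<open>real n < t\<close> n \<open>a < b\<close> by (intro divide_strict_left_mono) auto
    then have "seq_mean ?x n < p"
      using n(1) pt by (simp only: seq_mean_one_exception)
    moreover have "(b - a) / real (Suc n) < (b - a) / t"
      using n \<open>t > 1\<close> \<open>a < b\<close> by (intro divide_strict_left_mono) auto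
    then have "p < seq_mean ?x (Suc n)"
      using seq_mean_one_exception[of "Suc n" a b] pt by linarith
    moreover have "?x \<in> SEQ [a, b]" by (simp add: SEQ_def)
    ultimately have "\<exists>s. n < s \<and> s < Suc n \<and> seq_mean ?x s = p"
      using p n(1) unfolding IV_def by blast
    then show False by auto
  qed
  moreover have "n \<ge> 2" using \<open>t = real n\<close> \<open>t > 1\<close> by simp
  \<comment> \<open>With \<open>k + 1 = n\<close>, the weights are 1/n on \<open>a\<close> and (n -
    1)/n on \<open>b\<close>; \<open>n\<close> \<ge> 2 gives \<open>k\<close> \<ge> 1.\<close>
  ultimately show ?thesis
    using pt by (intro exI[of _ "int n - 1"]) (simp add: field_simps)
qed

theorem theorem2:
  fixes a b :: real
  assumes "a < b"
  shows "IV [a, b] =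
    {1 / (real_of_int k + 1) * a + real_of_int k / (real_of_int k + 1) * b | k :: int. k \<ge> 1}"
  using weighted_mean_in_IV[OF assms] IV_imp_weighted_mean[OF assms] by blast

end
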